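(* Let $\mathbb K$ be the field of real or complex numbers with its usual topology, let $\mathcal X$ be a linear space over $\mathbb K$, and let $\mathcal N(\mathcal X)$ be the exponential vector space consisting of all norms on $\mathcal X$ together with the constant zero function $O$, with $(f+g)(x)=f(x)+g(x)$, $(\alpha f)(x)=|\alpha|f(x)$, and $f\le g$ iff $f(x)\le g(x)$ for all $x\in\mathcal X$. Endow $\mathcal N(\mathcal X)$ with the point open topology. Then: (1) the addition $+:\mathcal N(\mathcal X)\times\mathcal N(\mathcal X)\to\mathcal N(\mathcal X)$ is continuous; (2) the scalar multiplication $\cdot:\mathbb K\times\mathcal N(\mathcal X)\to\mathcal N(\mathcal X)$ is continuous; (3) the partial order $\le$ is closed. Thus $\mathcal N(\mathcal X)$ with the point open topology forms a topological exponential vector space over $\mathbb K$.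
   Context: The point open topology on $\mathcal N(\mathcal X)$ is the topology with subbase $\{W(x,U): x\in\mathcal X,\ U \text{ open in } [0,\infty)\}$, where $W(x,U):=\{f\in\mathcal N(\mathcal X): f(x)\in U\}$ (topology of pointwise convergence). A partial order $\le$ on a topological space $Z$ is closed if its graph $\{(x,y)\in Z\times Z: x\le y\}$ is closed in $Z\times Z$ with the product topology. An exponential vector space (evs) over a field $K$ is a partially ordered set $(X,\le)$ with a binary operation $+$ on $X$ and a scalar multiplication $\cdot:K\times X\to X$ satisfying: ($A_1$) $(X,+)$ is a commutative semigroup with identity $\theta$. ($A_2$) If $x\le y$ then $x+z\le y+z$ and $\alpha\cdot x\le\alpha\cdot y$ for all $z\in X$, $\alpha\in K$. ($A_3$) For all $x,y\in X$ and $\alpha,\beta\in K$: (i) $\alpha\cdot(x+y)=\alpha\cdot x+\alpha\cdot y$; (ii) $\alpha\cdot(\beta\cdot x)=(\alpha\beta)\cdot x$; (iii) $(\alpha+\beta)\cdot x\le\alpha\cdot x+\beta\cdot x$; (iv) $1\cdot x=x$. ($A_4$) $\alpha\cdot x=\theta$ if and only if $\alpha=0$ or $x=\theta$. ($A_5$) $x+(-1)\cdot x=\theta$ if and only if $x\in X_0$, where $X_0:=\{z\in X: y\not\le z\ \text{for all } y\in X\smallsetminus\{z\}\}$. ($A_6$) For each $x\in X$ there exists $p\in X_0$ with $p\le x$. A topological exponential vector space over $\mathbb K$ is an evs over $\mathbb K$ equipped with a topology for which addition and scalar multiplication are continuous and the partial order is closed. *)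

theory Defs
  imports "HOL-Analysis.Analysis"
begin

definition minimal_elements :: "'x set \<Rightarrow> ('x \<Rightarrow> 'x \<Rightarrow> bool) \<Rightarrow> 'x set" where
  "minimal_elements X le = {z \<in> X. \<forall>y \<in> X - {z}. \<not> le y z}"

locale evs =
  fixes X :: "'x set"
    and le :: "'x \<Rightarrow> 'x \<Rightarrow> bool"
    and add :: "'x \<Rightarrow> 'x \<Rightarrow> 'x"
    and smult :: "'k::field \<Rightarrow> 'x \<Rightarrow> 'x"
    and zero :: 'x
  assumes partial_order: "partial_order_on X {(x, y) \<in> X \<times> X. le x y}"
    and add_closed: "\<lbrakk>x \<in> X; y \<in> X\<rbrakk> \<Longrightarrow> add x y \<in> X"
    and smult_closed: "x \<in> X \<Longrightarrow> smult \<alpha> x \<in> X"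
    and zero_closed: "zero \<in> X"
    and A1_assoc: "\<lbrakk>x \<in> X; y \<in> X; z \<in> X\<rbrakk> \<Longrightarrow> add (add x y) z = add x (add y z)"
    and A1_commute: "\<lbrakk>x \<in> X; y \<in> X\<rbrakk> \<Longrightarrow> add x y = add y x"
    and A1_identity: "x \<in> X \<Longrightarrow> add x zero = x"
    and A2_add: "\<lbrakk>x \<in> X; y \<in> X; z \<in> X; le x y\<rbrakk> \<Longrightarrow> le (add x z) (add y z)"
    and A2_smult: "\<lbrakk>x \<in> X; y \<in> X; le x y\<rbrakk> \<Longrightarrow> le (smult \<alpha> x) (smult \<alpha> y)"
    and A3_i: "\<lbrakk>x \<in> X; y \<in> X\<rbrakk> \<Longrightarrow> smult \<alpha> (add x y) = add (smult \<alpha> x) (smult \<alpha> y)"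
    and A3_ii: "x \<in> X \<Longrightarrow> smult \<alpha> (smult \<beta> x) = smult (\<alpha> * \<beta>) x"
    and A3_iii: "x \<in> X \<Longrightarrow> le (smult (\<alpha> + \<beta>) x) (add (smult \<alpha> x) (smult \<beta> x))"
    and A3_iv: "x \<in> X \<Longrightarrow> smult 1 x = x"
    and A4: "x \<in> X \<Longrightarrow> smult \<alpha> x = zero \<longleftrightarrow> \<alpha> = 0 \<or> x = zero"
    and A5: "x \<in> X \<Longrightarrow>
      add x (smult (- 1) x) = zero \<longleftrightarrow> x \<in> minimal_elements X le"
    and A6: "x \<in> X \<Longrightarrow> \<exists>p \<in> minimal_elements X le. le p x"

definition closed_order :: "'x topology \<Rightarrow> ('x \<Rightarrow> 'x \<Rightarrow> bool) \<Rightarrow> bool" where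
  "closed_order T le \<longleftrightarrow>
     closedin (prod_topology T T) {(x, y) \<in> topspace T \<times> topspace T. le x y}"

locale topological_evs = evs X le add smult zero
  for X :: "'x set"
    and le :: "'x \<Rightarrow> 'x \<Rightarrow> bool"
    and add :: "'x \<Rightarrow> 'x \<Rightarrow> 'x"
    and smult :: "'k::{field,topological_space} \<Rightarrow> 'x \<Rightarrow> 'x"
    and zero :: 'x +
  fixes T :: "'x topology"
  assumes topspace_eq: "topspace T = X"
    and continuous_add: "continuous_map (prod_topology T T) T (\<lambda>(x, y). add x y)"
    and continuous_smult:
      "continuous_map (prod_topology (euclidean :: 'k topology) T) T (\<lambda>(\<alpha>, x). smult \<alpha> x)"
    and closed_le: "closed_order T le"

text \<open>
  The linear space is a whole type \<open>'a\<close> whose scalar multiplication \<open>smul\<close> is passed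
  explicitly (as in the locale \<open>vector_space\<close>), so that no norm or topology is
  presupposed on it.
\<close>

definition is_norm :: "('k::real_normed_field \<Rightarrow> 'a::ab_group_add \<Rightarrow> 'a) \<Rightarrow> ('a \<Rightarrow> real) \<Rightarrow> bool" where
  "is_norm smul f \<longleftrightarrow>
     (\<forall>x. f x \<ge> 0) \<and>
     (\<forall>x. f x = 0 \<longleftrightarrow> x = 0) \<and>
     (\<forall>\<alpha> x. f (smul \<alpha> x) = norm \<alpha> * f x) \<and>
     (\<forall>x y. f (x + y) \<le> f x + f y)"

definition zero_norm :: "'a \<Rightarrow> real" where
  "zero_norm = (\<lambda>x. 0)"

definition norms :: "('k::real_normed_field \<Rightarrow> 'a::ab_group_add \<Rightarrow> 'a) \<Rightarrow> ('a \<Rightarrow> real) set" where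
  "norms smul = {f. is_norm smul f} \<union> {zero_norm}"

definition norm_add :: "('a \<Rightarrow> real) \<Rightarrow> ('a \<Rightarrow> real) \<Rightarrow> 'a \<Rightarrow> real" where
  "norm_add f g = (\<lambda>x. f x + g x)"

definition norm_smult :: "'k::real_normed_field \<Rightarrow> ('a \<Rightarrow> real) \<Rightarrow> 'a \<Rightarrow> real" where
  "norm_smult \<alpha> f = (\<lambda>x. norm \<alpha> * f x)"

definition norm_le :: "('a \<Rightarrow> real) \<Rightarrow> ('a \<Rightarrow> real) \<Rightarrow> bool" where
  "norm_le f g \<longleftrightarrow> (\<forall>x. f x \<le> g x)"

definition point_open ::
    "('k::real_normed_field \<Rightarrow> 'a::ab_group_add \<Rightarrow> 'a) \<Rightarrow> ('a \<Rightarrow> real) topology" where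
  "point_open smul = topology_generated_by
     {{f \<in> norms smul. f x \<in> U} | x U. openin (top_of_set {0..}) U}"

end

theory Submission
  imports Defs
begin

text \<open>
  The point open topology is the coarsest topology on \<open>norms smul\<close> for which all evaluations
  \<open>f \<mapsto> f x\<close> are continuous, so a map into it is continuous exactly when each of its
  coordinates is (\<open>continuous_map_into_point_open\<close>). After evaluation at a point, addition and
  scalar multiplication of norms become the sum of reals and the product \<open>norm \<alpha> * f x\<close>, and
  these are continuous. The graph of the order is the intersection, over all points \<open>x\<close>, of the
  closed conditions \<open>f x \<le> g x\<close>.

  Algebraically everything reduces to pointwise identities of nonnegative reals. The one
  structural remark is that the zero function lies below every norm, hence is the only minimal
  element: this gives the existence of a minimal element below each \<open>f\<close>, and it turns the
  characterisation of minimality by \<open>f + (-1) f = 0\<close> into \<open>2 f = 0 \<longleftrightarrow> f = 0\<close>.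

  Only \<open>norm \<alpha>\<close> enters, so the argument is uniform in the scalar field; the real and the complex
  case are instances of the statement for a real normed field.
\<close>

lemma norms_nonneg: "f \<in> norms smul \<Longrightarrow> 0 \<le> f x"
  by (auto simp: norms_def is_norm_def zero_norm_def)

lemma norms_add_closed:
  fixes smul :: "'k::real_normed_field \<Rightarrow> 'a::ab_group_add \<Rightarrow> 'a"
  assumes "f \<in> norms smul" "g \<in> norms smul"
  shows "norm_add f g \<in> norms smul"
proof -
  have "is_norm smul (norm_add f g)" if f: "is_norm smul f" and g: "is_norm smul g"
  proof -
    have "norm_add f g x = 0 \<longleftrightarrow> x = 0" for x
      using f g by (simp add: is_norm_def norm_add_def add_nonneg_eq_0_iff)
    moreover have "norm_add f g (x + y) \<le> norm_add f g x + norm_add f g y" for x y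
    proof -
      have "f (x + y) \<le> f x + f y" "g (x + y) \<le> g x + g y"
        using f g by (auto simp: is_norm_def)
      then show ?thesis by (simp add: norm_add_def)
    qed
    ultimately show ?thesis
      using f g by (simp add: is_norm_def norm_add_def distrib_left)
  qed
  moreover have "norm_add f zero_norm = f" "norm_add zero_norm f = f" for f :: "'a \<Rightarrow> real"
    by (simp_all add: norm_add_def zero_norm_def)
  ultimately show ?thesis
    using assms by (auto simp: norms_def)
qed

lemma norms_smult_closed:
  assumes "f \<in> norms smul"
  shows "norm_smult \<alpha> f \<in> norms smul"
proof (cases "\<alpha> = 0 \<or> f = zero_norm")
  case True
  then have "norm_smult \<alpha> f = zero_norm"
    by (auto simp: norm_smult_def zero_norm_def)
  then show ?thesis by (simp add: norms_def)
next
  case False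
  then have \<alpha>: "\<alpha> \<noteq> 0" and f: "is_norm smul f"
    using assms by (auto simp: norms_def)
  have "norm \<alpha> * f (x + y) \<le> norm \<alpha> * f x + norm \<alpha> * f y" for x y
    using f by (metis distrib_left is_norm_def mult_left_mono norm_ge_zero)
  then have "is_norm smul (norm_smult \<alpha> f)"
    using f \<alpha> by (auto simp: is_norm_def norm_smult_def)
  then show ?thesis by (simp add: norms_def)
qed

lemma minimal_elements_norms: "minimal_elements (norms smul) norm_le = {zero_norm}"
proof -
  have "zero_norm \<in> norms smul"
    by (simp add: norms_def)
  moreover have "norm_le zero_norm f" if "f \<in> norms smul" for f
    using norms_nonneg[OF that] by (simp add: norm_le_def zero_norm_def)
  moreover have "f = zero_norm" if "f \<in> norms smul" "norm_le f zero_norm" for f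
    using norms_nonneg[OF that(1)] that(2)
    by (auto simp: norm_le_def zero_norm_def fun_eq_iff intro: antisym)
  ultimately show ?thesis
    unfolding minimal_elements_def by blast
qed

lemma evs_norms:
  fixes smul :: "'k::real_normed_field \<Rightarrow> 'a::ab_group_add \<Rightarrow> 'a"
  shows "evs (norms smul) norm_le norm_add
    (norm_smult :: 'k \<Rightarrow> ('a \<Rightarrow> real) \<Rightarrow> 'a \<Rightarrow> real) zero_norm"
proof unfold_locales
  show "partial_order_on (norms smul) {(f, g) \<in> norms smul \<times> norms smul. norm_le f g}"
  proof -
    have "f = g" if "norm_le f g" "norm_le g f" for f g :: "'a \<Rightarrow> real"
      using that by (auto simp: norm_le_def fun_eq_iff intro: antisym)
    moreover have "norm_le f h" if "norm_le f g" "norm_le g h" for f g h :: "'a \<Rightarrow> real"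
      using that unfolding norm_le_def by (meson order_trans)
    moreover have "norm_le f f" for f :: "'a \<Rightarrow> real"
      by (simp add: norm_le_def)
    ultimately show ?thesis
      unfolding partial_order_on_def preorder_on_def refl_on_def trans_def antisym_def by blast
  qed
next
  fix f g :: "'a \<Rightarrow> real" and \<alpha> :: 'k
  assume "norm_le f g"
  then show "norm_le (norm_smult \<alpha> f) (norm_smult \<alpha> g)"
    by (simp add: norm_le_def norm_smult_def mult_left_mono)
next
  fix f :: "'a \<Rightarrow> real" and \<alpha> \<beta> :: 'k
  assume f: "f \<in> norms smul"
  show "norm_le (norm_smult (\<alpha> + \<beta>) f) (norm_add (norm_smult \<alpha> f) (norm_smult \<beta> f))"
    using norms_nonneg[OF f] norm_triangle_ineq[of \<alpha> \<beta>]
    by (simp add: norm_le_def norm_smult_def norm_add_def mult_right_mono flip: distrib_right)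
  show "norm_smult \<alpha> f = zero_norm \<longleftrightarrow> \<alpha> = 0 \<or> f = zero_norm"
    by (auto simp: norm_smult_def zero_norm_def fun_eq_iff)
  show "norm_add f (norm_smult (- 1 :: 'k) f) = zero_norm
      \<longleftrightarrow> f \<in> minimal_elements (norms smul) norm_le"
    unfolding minimal_elements_norms
    by (simp add: norm_add_def norm_smult_def zero_norm_def fun_eq_iff)
  show "\<exists>p \<in> minimal_elements (norms smul) norm_le. norm_le p f"
    unfolding minimal_elements_norms
    using norms_nonneg[OF f] by (simp add: norm_le_def zero_norm_def)
qed (auto simp: norms_add_closed norms_smult_closed,
    auto simp: norms_def norm_add_def norm_smult_def zero_norm_def norm_le_def
      algebra_simps norm_mult)

lemma topspace_point_open: "topspace (point_open smul) = norms smul"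
proof -
  have "openin (top_of_set {0..}) {0::real..}"
    by simp
  moreover have "norms smul = {f \<in> norms smul. f undefined \<in> {0..}}"
    using norms_nonneg by fastforce
  ultimately have "norms smul \<in> {{f \<in> norms smul. f x \<in> U} | x U. openin (top_of_set {0..}) U}"
    by blast
  then show ?thesis
    unfolding point_open_def topology_generated_by_topspace by blast
qed

lemma continuous_map_point_open_eval:
  "continuous_map (point_open smul) euclidean (\<lambda>f. f x)"
proof -
  have "openin (point_open smul) {f \<in> norms smul. f x \<in> V}" if "open V" for V
  proof -
    \<comment> \<open>Subbasic sets use open subsets of the half line; norms only see \<open>V \<inter> {0..}\<close>.\<close>
    have "{f \<in> norms smul. f x \<in> V} = {f \<in> norms smul. f x \<in> {0..} \<inter> V}"
      using norms_nonneg by fastforce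
    moreover have "openin (top_of_set {0..}) ({0..} \<inter> V)"
      using that by (rule openin_open_Int)
    ultimately show ?thesis
      unfolding point_open_def by (intro topology_generated_by_Basis) blast
  qed
  then show ?thesis
    by (simp add: continuous_map_def topspace_point_open)
qed

text \<open>
  The universal property of the topology of pointwise convergence: the preimage of a subbasic set
  \<open>W(x, U)\<close> under \<open>h\<close> is the preimage of \<open>U\<close> under the coordinate \<open>\<lambda>t. h t x\<close>.
\<close>

lemma continuous_map_into_point_open:
  assumes into: "\<And>t. t \<in> topspace T \<Longrightarrow> h t \<in> norms smul"
    and coord: "\<And>x. continuous_map T euclidean (\<lambda>t. h t x)"
  shows "continuous_map T (point_open smul) h"
  unfolding point_open_def
proof (rule continuous_on_generated_topo)
  fix W
  assume "W \<in> {{f \<in> norms smul. f x \<in> U} | x U. openin (top_of_set {0..}) U}"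
  then obtain x U where W: "W = {f \<in> norms smul. f x \<in> U}" and "openin (top_of_set {0..}) U"
    by blast
  then obtain V where "open V" and U: "U = {0..} \<inter> V"
    by (auto simp: openin_open)
  have "h -` W \<inter> topspace T = {t \<in> topspace T. h t x \<in> V}"
    using into norms_nonneg by (fastforce simp: W U)
  with coord[of x] \<open>open V\<close> show "openin T (h -` W \<inter> topspace T)"
    by (simp add: continuous_map_def)
next
  show "h ` topspace T \<subseteq> \<Union> {{f \<in> norms smul. f x \<in> U} | x U. openin (top_of_set {0..}) U}"
    using into topspace_point_open[of smul]
    unfolding point_open_def topology_generated_by_topspace by blast
qed

lemma continuous_map_point_open_eval_compose:
  assumes "continuous_map T (point_open smul) h"
  shows "continuous_map T euclidean (\<lambda>t. h t x)"
  using continuous_map_compose[OF assms continuous_map_point_open_eval] by (simp add: o_def)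

lemma continuous_map_norm_add:
  "continuous_map (prod_topology (point_open smul) (point_open smul)) (point_open smul)
     (\<lambda>(f, g). norm_add f g)"
proof (rule continuous_map_into_point_open)
  show "continuous_map (prod_topology (point_open smul) (point_open smul)) euclidean
      (\<lambda>p. (case p of (f, g) \<Rightarrow> norm_add f g) x)" for x
    unfolding norm_add_def case_prod_beta
    by (intro continuous_map_add continuous_map_point_open_eval_compose[where smul = smul]
        continuous_map_fst continuous_map_snd)
qed (auto simp: topspace_point_open norms_add_closed)

lemma continuous_map_norm_smult:
  fixes smul :: "'k::real_normed_field \<Rightarrow> 'a::ab_group_add \<Rightarrow> 'a"
  shows "continuous_map (prod_topology (euclidean :: 'k topology) (point_open smul))
    (point_open smul) (\<lambda>(\<alpha>, f). norm_smult \<alpha> f)"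
proof (rule continuous_map_into_point_open)
  show "continuous_map (prod_topology (euclidean :: 'k topology) (point_open smul)) euclidean
      (\<lambda>p. (case p of (\<alpha>, f) \<Rightarrow> norm_smult \<alpha> f) x)" for x
    unfolding norm_smult_def case_prod_beta
    by (intro continuous_map_real_mult continuous_map_norm
        continuous_map_point_open_eval_compose[where smul = smul] continuous_map_fst continuous_map_snd)
qed (auto simp: topspace_point_open norms_smult_closed)

lemma closed_order_norm_le: "closed_order (point_open smul) norm_le"
proof -
  let ?P = "prod_topology (point_open smul) (point_open smul)"
  have "closedin ?P {p \<in> topspace ?P. fst p x - snd p x \<in> {..0}}" for x
    by (intro closedin_continuous_map_preimage[where Y = euclidean] continuous_map_diff
        continuous_map_point_open_eval_compose[where smul = smul] continuous_map_fst continuous_map_snd)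
      (simp flip: closed_closedin)
  then have "closedin ?P (\<Inter>x. {p \<in> topspace ?P. fst p x - snd p x \<in> {..0}})"
    by (intro closedin_INT) auto
  also have "(\<Inter>x. {p \<in> topspace ?P. fst p x - snd p x \<in> {..0}}) =
      {(f, g) \<in> topspace (point_open smul) \<times> topspace (point_open smul). norm_le f g}"
    by (auto simp: norm_le_def)
  finally show ?thesis
    unfolding closed_order_def .
qed

lemma topological_evs_norms:
  fixes smul :: "'k::real_normed_field \<Rightarrow> 'a::ab_group_add \<Rightarrow> 'a"
  shows "topological_evs (norms smul) norm_le norm_add
    (norm_smult :: 'k \<Rightarrow> ('a \<Rightarrow> real) \<Rightarrow> 'a \<Rightarrow> real) zero_norm (point_open smul)"
  by (intro topological_evs.intro topological_evs_axioms.intro evs_norms topspace_point_open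
      continuous_map_norm_add continuous_map_norm_smult closed_order_norm_le)

theorem theorem3p3:
  shows
    "(\<forall>smul :: real \<Rightarrow> 'a::ab_group_add \<Rightarrow> 'a. vector_space smul \<longrightarrow>
        continuous_map (prod_topology (point_open smul) (point_open smul)) (point_open smul)
          (\<lambda>(f, g). norm_add f g) \<and>
        continuous_map (prod_topology (euclidean :: real topology) (point_open smul)) (point_open smul)
          (\<lambda>(\<alpha>, f). norm_smult \<alpha> f) \<and>
        closed_order (point_open smul) norm_le \<and>
        topological_evs (norms smul) norm_le norm_add
          (norm_smult :: real \<Rightarrow> ('a \<Rightarrow> real) \<Rightarrow> 'a \<Rightarrow> real) zero_norm (point_open smul)) \<and>
     (\<forall>smul :: complex \<Rightarrow> 'a \<Rightarrow> 'a. vector_space smul \<longrightarrow>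
        continuous_map (prod_topology (point_open smul) (point_open smul)) (point_open smul)
          (\<lambda>(f, g). norm_add f g) \<and>
        continuous_map (prod_topology (euclidean :: complex topology) (point_open smul)) (point_open smul)
          (\<lambda>(\<alpha>, f). norm_smult \<alpha> f) \<and>
        closed_order (point_open smul) norm_le \<and>
        topological_evs (norms smul) norm_le norm_add
          (norm_smult :: complex \<Rightarrow> ('a \<Rightarrow> real) \<Rightarrow> 'a \<Rightarrow> real) zero_norm (point_open smul))"
  by (intro conjI allI impI continuous_map_norm_add continuous_map_norm_smult
      closed_order_norm_le topological_evs_norms)

end
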